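(* Let $G$ be a finite simple connected graph with edges $e_1,\dots,e_m$. If $z$ is a critical point of the weighted tree number $\tau$ in the interior of $P(G)$, then $z$ is a global maximum for $\tau$ on $P(G)$. In particular, if $G$ is equiarboreal, then the unweighted graph $\underline{\omega}=(1,1,\dots,1)$ is a global maximum for $\tau$ on $P(G)$.
   Context: The weighted edge polytope is $P(G)=\{(x_1,\dots,x_m): x_j\ge 0,\ \sum_{j=1}^m x_j=m\}$; its interior consists of the points with all $x_j>0$. The weighted tree number is $\tau(x)=\sum_{T}\prod_{e_j\in T}x_j$, the sum being over all spanning trees $T$ of $G$. A point $z\in P(G)$ is critical for $\tau$ if the directional derivative of $\tau$ at $z$ vanishes in every direction $y\in\mathbf{R}^m$ with $\sum_j y_j=0$. An (unweighted) graph $G$ is equiarboreal if every edge of $G$ is contained in the same number of spanning trees of $G$. *)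

theory Defs
  imports "HOL-Analysis.Analysis"
begin

section \<open>Finite simple graphs and their spanning trees\<close>

text \<open>
  A graph is a vertex set \<open>V\<close> together with a set \<open>E\<close> of two-element subsets of \<open>V\<close>.
\<close>

definition finite_simple_graph :: "'v set \<Rightarrow> 'v set set \<Rightarrow> bool" where
  "finite_simple_graph V E \<longleftrightarrow> finite V \<and> (\<forall>a\<in>E. a \<subseteq> V \<and> card a = 2)"

definition adjacency :: "'v set set \<Rightarrow> ('v \<times> 'v) set" where
  "adjacency E = {(u, v). {u, v} \<in> E}"

text \<open>The graph without vertices does not count as connected.\<close>

definition connected_graph :: "'v set \<Rightarrow> 'v set set \<Rightarrow> bool" where
  "connected_graph V E \<longleftrightarrow> V \<noteq> {} \<and> (\<forall>u\<in>V. \<forall>v\<in>V. (u, v) \<in> (adjacency E)\<^sup>*)"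

text \<open>A cycle is given by the list of its vertices, the first one not being repeated at the end.\<close>

definition graph_cycle :: "'v set set \<Rightarrow> 'v list \<Rightarrow> bool" where
  "graph_cycle E vs \<longleftrightarrow> 3 \<le> length vs \<and> distinct vs \<and>
     (\<forall>i<length vs. {vs ! i, vs ! (Suc i mod length vs)} \<in> E)"

definition tree_graph :: "'v set \<Rightarrow> 'v set set \<Rightarrow> bool" where
  "tree_graph V E \<longleftrightarrow> connected_graph V E \<and> \<not> (\<exists>vs. graph_cycle E vs)"

text \<open>
  A spanning tree has the same vertex set as the whole graph, so it is identified with its
  edge set.
\<close>

definition spanning_trees :: "'v set \<Rightarrow> 'v set set \<Rightarrow> 'v set set set" where
  "spanning_trees V E = {T. T \<subseteq> E \<and> tree_graph V T}"

definition equiarboreal :: "'v set \<Rightarrow> 'v set set \<Rightarrow> bool" where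
  "equiarboreal V E \<longleftrightarrow>
     (\<forall>a\<in>E. \<forall>b\<in>E. card {T \<in> spanning_trees V E. a \<in> T} = card {T \<in> spanning_trees V E. b \<in> T})"


section \<open>Edge weights\<close>

text \<open>
  The space of real \<open>m\<close>-tuples is represented by the functions on \<open>nat\<close> that vanish outside
  \<open>{1..m}\<close>. Unlike a finite index type, this admits \<open>m = 0\<close>, which occurs for the graph with
  one vertex.
\<close>

definition tuples :: "nat \<Rightarrow> (nat \<Rightarrow> real) set" where
  "tuples m = {x. \<forall>j. j \<notin> {1..m} \<longrightarrow> x j = 0}"

definition edge_polytope :: "nat \<Rightarrow> (nat \<Rightarrow> real) set" where
  "edge_polytope m = {x \<in> tuples m. (\<forall>j\<in>{1..m}. 0 \<le> x j) \<and> (\<Sum>j=1..m. x j) = real m}"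

text \<open>This is the relative interior: the polytope lies in a hyperplane.\<close>

definition edge_polytope_interior :: "nat \<Rightarrow> (nat \<Rightarrow> real) set" where
  "edge_polytope_interior m = {x \<in> edge_polytope m. \<forall>j\<in>{1..m}. 0 < x j}"

text \<open>The function \<open>e\<close> enumerates the edges as \<open>e 1, \<dots>, e m\<close>.\<close>

definition weighted_tree_number ::
    "'v set \<Rightarrow> 'v set set \<Rightarrow> nat \<Rightarrow> (nat \<Rightarrow> 'v set) \<Rightarrow> (nat \<Rightarrow> real) \<Rightarrow> real" where
  "weighted_tree_number V E m e x =
     (\<Sum>T\<in>spanning_trees V E. \<Prod>j\<in>{j \<in> {1..m}. e j \<in> T}. x j)"

definition critical_point :: "nat \<Rightarrow> ((nat \<Rightarrow> real) \<Rightarrow> real) \<Rightarrow> (nat \<Rightarrow> real) \<Rightarrow> bool" where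
  "critical_point m f z \<longleftrightarrow> z \<in> edge_polytope m \<and>
     (\<forall>y\<in>tuples m. (\<Sum>j=1..m. y j) = 0 \<longrightarrow>
        ((\<lambda>t. f (\<lambda>j. z j + t * y j)) has_real_derivative 0) (at 0))"

definition unweighted :: "nat \<Rightarrow> nat \<Rightarrow> real" where
  "unweighted m = (\<lambda>j. if j \<in> {1..m} then 1 else 0)"

definition global_max_on :: "('a \<Rightarrow> real) \<Rightarrow> 'a set \<Rightarrow> 'a \<Rightarrow> bool" where
  "global_max_on f S z \<longleftrightarrow> z \<in> S \<and> (\<forall>x\<in>S. f x \<le> f z)"

end

theory Submission
  imports
    Defs
    "HOL-Computational_Algebra.Fundamental_Theorem_Algebra"
    "Jordan_Normal_Form.Determinant"
begin

text \<open>
  Let \<open>z\<close> be an interior critical point, \<open>x\<close> any point of the polytope, and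
  \<open>p(t) = \<tau>(z + t(x - z))\<close>. By the matrix-tree theorem \<open>p(t)\<close> is the determinant of a reduced
  Laplacian, so a complex root \<open>t\<close> of \<open>p\<close> gives a nonconstant \<open>\<phi>\<close> on the vertices with
  vanishing energy: \<open>\<Sum> |\<phi> u - \<phi> v|\<^sup>2 (z\<^sub>u\<^sub>v + t (x\<^sub>u\<^sub>v - z\<^sub>u\<^sub>v)) = 0\<close>, the sum being over the edges.
  With \<open>A > 0\<close> and \<open>B \<ge> 0\<close> the energies for \<open>z\<close> and \<open>x\<close>, this reads \<open>A + t (B - A) = 0\<close>. Hence
  \<open>p(t) = p(0) \<Prod> (1 + \<mu>\<^sub>i t)\<close> with real \<open>\<mu>\<^sub>i \<ge> -1\<close>. Criticality means \<open>\<Sum> \<mu>\<^sub>i = 0\<close>, and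
  \<open>1 + \<mu> \<le> exp \<mu>\<close> gives \<open>p(1) \<le> p(0)\<close>.
\<close>

section \<open>Spanning trees as parent maps\<close>

text \<open>
  A spanning tree is encoded by the map that sends each vertex other than the root \<open>r\<close> to the next
  vertex on its path to \<open>r\<close>. Well-foundedness says that the iterates of the map reach \<open>r\<close>.
\<close>

definition parent_rel :: "'v set \<Rightarrow> ('v \<Rightarrow> 'v) \<Rightarrow> ('v \<times> 'v) set" where
  "parent_rel U f = {(f v, v) | v. v \<in> U}"

definition parent_maps :: "'v set \<Rightarrow> 'v \<Rightarrow> ('v \<Rightarrow> 'v) set" where
  "parent_maps V r = {f \<in> (V - {r}) \<rightarrow>\<^sub>E V. wf (parent_rel (V - {r}) f)}"

definition parent_edges :: "'v set \<Rightarrow> ('v \<Rightarrow> 'v) \<Rightarrow> 'v set set" where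
  "parent_edges U f = (\<lambda>v. {v, f v}) ` U"

section \<open>Parent maps yield trees, and different maps yield different trees\<close>

lemma parent_map_neq:
  assumes "wf (parent_rel U f)" "v \<in> U"
  shows "f v \<noteq> v"
  using assms wf_not_refl[of "parent_rel U f" v] unfolding parent_rel_def by auto

lemma parent_map_asym:
  assumes "wf (parent_rel U f)" "v \<in> U" "u \<in> U" "f v = u"
  shows "f u \<noteq> v"
proof
  assume "f u = v"
  then have "(u, v) \<in> parent_rel U f" "(v, u) \<in> parent_rel U f"
    using assms unfolding parent_rel_def by auto
  then show False
    using wf_asym[OF assms(1)] by blast
qed

text \<open>If two vertices gave the same edge, each would be the parent of the other, a 2-cycle
  that well-foundedness excludes.\<close>

lemma inj_on_parent_edge:
  assumes "wf (parent_rel U f)"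
  shows "inj_on (\<lambda>v. {v, f v}) U"
  by (rule inj_onI) (metis assms doubleton_eq_iff parent_map_asym)

lemma sym_adjacency: "sym (adjacency F)"
  unfolding adjacency_def sym_def by (auto simp: insert_commute)

text \<open>Following parents leads every vertex to \<open>r\<close>, by induction from the root
  outwards; symmetry of adjacency then joins any two vertices through \<open>r\<close>.\<close>

lemma connected_graph_parent_edges:
  assumes f: "f \<in> parent_maps V r" and r: "r \<in> V"
  shows "connected_graph V (parent_edges (V - {r}) f)"
proof -
  let ?A = "adjacency (parent_edges (V - {r}) f)"
  have wf: "wf (parent_rel (V - {r}) f)"
    using f unfolding parent_maps_def by auto
  have root: "v \<in> V \<longrightarrow> (v, r) \<in> ?A\<^sup>*" for v
  proof (induction v rule: wf_induct_rule[OF wf])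
    case (1 v)
    show ?case
    proof (cases "v \<in> V - {r}")
      case True
      then have "(f v, v) \<in> parent_rel (V - {r}) f" "f v \<in> V" "(v, f v) \<in> ?A"
        using f unfolding parent_rel_def parent_maps_def adjacency_def parent_edges_def by auto
      with 1 show ?thesis
        by (blast intro: converse_rtrancl_into_rtrancl)
    qed auto
  qed
  have "(r, v) \<in> ?A\<^sup>*" if "v \<in> V" for v
    using root that sym_rtrancl[OF sym_adjacency] by (meson symD)
  with root r show ?thesis
    unfolding connected_graph_def by (blast intro: rtrancl_trans)
qed

lemma no_cycle_parent_edges:
  assumes wf: "wf (parent_rel U f)" and fin: "finite U"
  shows "\<not> graph_cycle (parent_edges U f) vs"
proof
  assume cyc: "graph_cycle (parent_edges U f) vs"
  define k where "k = length vs"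
  have k: "3 \<le> k" and dist: "distinct vs"
    and edge: "\<And>i. i < k \<Longrightarrow> {vs ! i, vs ! (Suc i mod k)} \<in> parent_edges U f"
    using cyc unfolding graph_cycle_def k_def by auto
  \<comment> \<open>A finite acyclic relation has a well-founded converse, so some vertex
    \<open>x\<close> of the cycle has no child on the cycle.\<close>
  have "parent_rel U f = (\<lambda>v. (f v, v)) ` U"
    unfolding parent_rel_def by auto
  then have "finite (parent_rel U f)"
    using fin by simp
  then have "wf ((parent_rel U f)\<inverse>)"
    using wf wf_acyclic finite_acyclic_wf_converse by blast
  moreover have "vs ! 0 \<in> set vs"
    using k unfolding k_def by (intro nth_mem) auto
  ultimately obtain x where x: "x \<in> set vs"
    and top: "\<And>y. (y, x) \<in> (parent_rel U f)\<inverse> \<Longrightarrow> y \<notin> set vs"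
    by (rule wfE_min) blast
  obtain i where i: "i < k" "vs ! i = x"
    using x unfolding k_def by (auto simp: in_set_conv_nth)
  text \<open>Both neighbours of a vertex of maximal depth would have to be its parent.\<close>
  have parent: "f x = y" if e: "{x, y} \<in> parent_edges U f" "y \<in> set vs" for y
  proof -
    obtain u where u: "u \<in> U" "{x, y} = {u, f u}"
      using e(1) unfolding parent_edges_def by blast
    have "u \<noteq> y \<or> f u \<noteq> x"
      using top[of y] e(2) u(1) unfolding parent_rel_def by auto
    with u(2) show ?thesis
      by (auto simp: doubleton_eq_iff)
  qed
  \<comment> \<open>\<open>s\<close> and \<open>p\<close> are the cyclic successor and predecessor
    of position \<open>i\<close>; they differ because the cycle has at least three vertices.\<close>
  define s where "s = Suc i mod k"
  define p where "p = (if i = 0 then k - 1 else i - 1)"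
  have s: "s < k" and p: "p < k" and ps: "Suc p mod k = i"
    using i k unfolding s_def p_def by auto
  have "p \<noteq> s"
    using i k unfolding s_def p_def by (auto simp: mod_Suc split: if_splits)
  then have "vs ! p \<noteq> vs ! s"
    using dist s p nth_eq_iff_index_eq unfolding k_def by blast
  moreover have "f x = vs ! s"
    using parent[of "vs ! s"] edge[of i] i s unfolding s_def k_def by auto
  moreover have "f x = vs ! p"
    using parent[of "vs ! p"] edge[of p] i p ps unfolding k_def by (auto simp: insert_commute)
  ultimately show False
    by simp
qed

text \<open>Induction from the root outwards: if \<open>{v, f v}\<close> were the edge of some
  \<open>u\<close> under \<open>g\<close> with \<open>f v = u\<close> and \<open>g u = v\<close>,
  then the induction hypothesis at the parent \<open>u\<close> would give \<open>f u = v\<close>, a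
  2-cycle.\<close>

lemma inj_on_parent_edges: "inj_on (parent_edges (V - {r})) (parent_maps V r)"
proof (rule inj_onI)
  fix f g
  assume f: "f \<in> parent_maps V r" and g: "g \<in> parent_maps V r"
    and eq: "parent_edges (V - {r}) f = parent_edges (V - {r}) g"
  have wf: "wf (parent_rel (V - {r}) f)" and fV: "f \<in> (V - {r}) \<rightarrow>\<^sub>E V" and gV: "g \<in> (V - {r}) \<rightarrow>\<^sub>E V"
    using f g unfolding parent_maps_def by auto
  have "v \<in> V - {r} \<longrightarrow> f v = g v" for v
  proof (induction v rule: wf_induct_rule[OF wf])
    case (1 v)
    show ?case
    proof
      assume v: "v \<in> V - {r}"
      then have "{v, f v} \<in> parent_edges (V - {r}) g"
        unfolding eq[symmetric] by (auto simp: parent_edges_def)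
      then obtain u where u: "u \<in> V - {r}" "{v, f v} = {u, g u}"
        unfolding parent_edges_def by auto
      show "f v = g v"
      proof (rule ccontr)
        assume "f v \<noteq> g v"
        then have *: "f v = u" "g u = v"
          using u(2) by (auto simp: doubleton_eq_iff)
        moreover have "(u, v) \<in> parent_rel (V - {r}) f"
          using * v unfolding parent_rel_def by auto
        ultimately have "f u = v"
          using 1 u by auto
        then show False
          using parent_map_asym[OF wf v u(1)] * by auto
      qed
    qed
  qed
  then show "f = g"
    using fV gV by (intro PiE_ext) auto
qed

section \<open>Every spanning tree comes from a parent map\<close>

lemma rtrancl_adjacency_distinct_path:
  assumes "(u, v) \<in> (adjacency F)\<^sup>*"
  shows "\<exists>vs. vs \<noteq> [] \<and> hd vs = u \<and> last vs = v \<and> distinct vs \<and> successively (\<lambda>x y. {x, y} \<in> F) vs"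
  using assms
proof (induction rule: converse_rtrancl_induct)
  case base
  show ?case
    by (rule exI[of _ "[v]"]) auto
next
  case (step u w)
  then obtain vs where vs: "vs \<noteq> []" "hd vs = w" "last vs = v" "distinct vs"
    "successively (\<lambda>x y. {x, y} \<in> F) vs"
    by auto
  have uw: "{u, w} \<in> F"
    using step(1) unfolding adjacency_def by auto
  show ?case
  proof (cases "u \<in> set vs")
    \<comment> \<open>The path already visits \<open>u\<close>, so its final segment starting at
      \<open>u\<close> is enough.\<close>
    case True
    then obtain ys zs where "vs = ys @ u # zs"
      by (auto simp: in_set_conv_decomp)
    with vs show ?thesis
      by (intro exI[of _ "u # zs"]) (auto simp: successively_append_iff)
  next
    case False
    with vs uw show ?thesis
      by (intro exI[of _ "u # vs"]) (cases vs; auto)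
  qed
qed

text \<open>The edge \<open>{u, v}\<close> closes a simple path in \<open>F\<close> from
  \<open>u\<close> to \<open>v\<close>; this path has at least three vertices because
  \<open>u\<close> and \<open>v\<close> are distinct and not adjacent in \<open>F\<close>. Hence an
  acyclic graph has no edge beyond those of a connected spanning subgraph.\<close>

lemma graph_cycle_if_edge_outside_connected:
  assumes conn: "connected_graph V F" and F: "F \<subseteq> T"
    and uv: "u \<in> V" "v \<in> V" "u \<noteq> v" "{u, v} \<in> T" "{u, v} \<notin> F"
  shows "\<exists>vs. graph_cycle T vs"
proof -
  have "(u, v) \<in> (adjacency F)\<^sup>*"
    using conn uv unfolding connected_graph_def by auto
  then obtain vs where vs: "vs \<noteq> []" "hd vs = u" "last vs = v" "distinct vs"
    "successively (\<lambda>x y. {x, y} \<in> F) vs"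
    using rtrancl_adjacency_distinct_path by metis
  have "length vs \<noteq> 1"
    using vs uv by (auto simp: length_Suc_conv)
  moreover have "length vs \<noteq> 2"
  proof
    assume "length vs = 2"
    then obtain a b where "vs = [a, b]"
      by (auto simp: length_Suc_conv numeral_2_eq_2)
    with vs uv show False
      by auto
  qed
  ultimately have len: "3 \<le> length vs"
    using vs(1) by (cases vs; cases "tl vs"; cases "tl (tl vs)"; auto)
  have "{vs ! i, vs ! (Suc i mod length vs)} \<in> T" if i: "i < length vs" for i
  proof (cases "Suc i < length vs")
    case True
    then show ?thesis
      using vs(5) F by (auto simp: successively_conv_nth)
  next
    case False
    then have i: "i = length vs - 1" "Suc i = length vs"
      using i by auto
    then have "vs ! i = v" "vs ! 0 = u"
      using vs by (simp_all add: last_conv_nth hd_conv_nth)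
    with i uv show ?thesis
      by (simp add: insert_commute)
  qed
  with len vs(4) show ?thesis
    unfolding graph_cycle_def by blast
qed

text \<open>Breadth-first tree: each vertex chooses a neighbour strictly closer to \<open>r\<close>,
  so the distance \<open>d\<close> to the root is a measure witnessing well-foundedness.\<close>

lemma connected_graph_parent_map:
  assumes conn: "connected_graph V T" and T: "\<And>a. a \<in> T \<Longrightarrow> a \<subseteq> V" and r: "r \<in> V"
  shows "\<exists>f \<in> parent_maps V r. parent_edges (V - {r}) f \<subseteq> T"
proof -
  let ?A = "adjacency T"
  define d where "d v = (LEAST k. (v, r) \<in> ?A ^^ k)" for v
  have "\<exists>u. {v, u} \<in> T \<and> d u < d v" if v: "v \<in> V - {r}" for v
  proof -
    have "\<exists>k. (v, r) \<in> ?A ^^ k"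
      using conn v r unfolding connected_graph_def by (auto simp: rtrancl_power)
    then have dv: "(v, r) \<in> ?A ^^ d v"
      unfolding d_def by (rule LeastI_ex)
    have "d v \<noteq> 0"
      using dv v by (metis DiffE insertI1 pair_in_Id_conv relpow.simps(1))
    then obtain k where k: "d v = Suc k"
      by (cases "d v") auto
    with dv obtain u where u: "(v, u) \<in> ?A" "(u, r) \<in> ?A ^^ k"
      by (metis relpow_Suc_D2)
    then have "d u \<le> k"
      unfolding d_def by (intro Least_le)
    with u k show ?thesis
      unfolding adjacency_def by auto
  qed
  then obtain g where g: "\<And>v. v \<in> V - {r} \<Longrightarrow> {v, g v} \<in> T \<and> d (g v) < d v"
    by metis
  let ?f = "restrict g (V - {r})"
  have gV: "g v \<in> V" if "v \<in> V - {r}" for v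
    using g[OF that] T[of "{v, g v}"] by auto
  have "parent_rel (V - {r}) ?f \<subseteq> Wellfounded.measure d"
  proof
    fix x
    assume "x \<in> parent_rel (V - {r}) ?f"
    then obtain v where "v \<in> V - {r}" "x = (?f v, v)"
      unfolding parent_rel_def by blast
    then show "x \<in> Wellfounded.measure d"
      using g by simp
  qed
  then have "wf (parent_rel (V - {r}) ?f)"
    by (rule wf_subset[OF wf_measure])
  moreover have "?f \<in> (V - {r}) \<rightarrow>\<^sub>E V"
    using gV by auto
  ultimately have "?f \<in> parent_maps V r"
    unfolding parent_maps_def by auto
  moreover have "parent_edges (V - {r}) ?f \<subseteq> T"
    using g unfolding parent_edges_def by auto
  ultimately show ?thesis
    by blast
qed

text \<open>For surjectivity, a tree \<open>T\<close> contains the edges of some parent map; these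
  already connect \<open>V\<close>, so a further edge of \<open>T\<close> would create a
  cycle.\<close>

lemma bij_betw_parent_maps_spanning_trees:
  assumes G: "finite_simple_graph V E" and r: "r \<in> V"
  shows "bij_betw (parent_edges (V - {r}))
    {f \<in> parent_maps V r. parent_edges (V - {r}) f \<subseteq> E} (spanning_trees V E)"
proof (rule bij_betw_imageI)
  show "inj_on (parent_edges (V - {r})) {f \<in> parent_maps V r. parent_edges (V - {r}) f \<subseteq> E}"
    by (rule inj_on_subset[OF inj_on_parent_edges]) auto
  show "parent_edges (V - {r}) ` {f \<in> parent_maps V r. parent_edges (V - {r}) f \<subseteq> E} = spanning_trees V E"
  proof (intro equalityI subsetI)
    fix T
    assume "T \<in> parent_edges (V - {r}) ` {f \<in> parent_maps V r. parent_edges (V - {r}) f \<subseteq> E}"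
    then obtain f where f: "f \<in> parent_maps V r" "parent_edges (V - {r}) f \<subseteq> E"
      "T = parent_edges (V - {r}) f"
      by auto
    moreover have "\<not> graph_cycle T vs" for vs
      unfolding f(3) using f(1) G
      by (intro no_cycle_parent_edges) (auto simp: parent_maps_def finite_simple_graph_def)
    ultimately show "T \<in> spanning_trees V E"
      using connected_graph_parent_edges[OF f(1) r]
      unfolding spanning_trees_def tree_graph_def by auto
  next
    fix T
    assume "T \<in> spanning_trees V E"
    then have T: "T \<subseteq> E" "connected_graph V T" "\<nexists>vs. graph_cycle T vs"
      unfolding spanning_trees_def tree_graph_def by auto
    have edge: "a \<subseteq> V" "card a = 2" if "a \<in> T" for a
      using that T(1) G unfolding finite_simple_graph_def by auto
    obtain f where f: "f \<in> parent_maps V r" "parent_edges (V - {r}) f \<subseteq> T"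
      using connected_graph_parent_map[OF T(2) edge(1) r] by auto
    have "T \<subseteq> parent_edges (V - {r}) f"
    proof
      fix a
      assume a: "a \<in> T"
      then obtain u v where uv: "a = {u, v}" "u \<noteq> v"
        using edge(2) by (meson card_2_iff)
      show "a \<in> parent_edges (V - {r}) f"
        using graph_cycle_if_edge_outside_connected[OF connected_graph_parent_edges[OF f(1) r] f(2)]
          T(3) uv a edge(1)[OF a] by auto
    qed
    with f T(1) show "T \<in> parent_edges (V - {r}) ` {f \<in> parent_maps V r. parent_edges (V - {r}) f \<subseteq> E}"
      by auto
  qed
qed

section \<open>The matrix-tree theorem\<close>

lemma permutes_upt_less:
  fixes n :: nat
  assumes "p permutes {0..<n}" "i < n"
  shows "p i < n"
  using permutes_in_image[OF assms(1), of i] assms(2) by auto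

text \<open>In a nonzero product every index moved by \<open>p\<close> is moved along
  \<open>f\<close>. The moved vertices would then form a nonempty set closed under taking parents,
  with no minimal element.\<close>

lemma prod_permutes_parent_eq_0:
  fixes f :: "'v \<Rightarrow> 'v" and g :: "nat \<Rightarrow> 'v"
  assumes wf: "wf (parent_rel U f)" and g: "bij_betw g {0..<n} U"
    and p: "p permutes {0..<n}" and "p \<noteq> id"
  shows "(\<Prod>i=0..<n. of_bool (p i = i) - of_bool (f (g i) = g (p i)) :: 'a :: comm_ring_1) = 0"
proof (rule ccontr)
  assume nz: "\<not> ?thesis"
  have move: "f (g i) = g (p i)" if "i < n" "p i \<noteq> i" for i
  proof (rule ccontr)
    assume "f (g i) \<noteq> g (p i)"
    with that show False
      using nz by (auto simp: prod_zero_iff intro!: prod_zero)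
  qed
  define M where "M = g ` {i. i < n \<and> p i \<noteq> i}"
  obtain i0 where "p i0 \<noteq> i0"
    using \<open>p \<noteq> id\<close> by (auto simp: fun_eq_iff)
  moreover have "i0 < n"
    using calculation p by (metis atLeastLessThan_iff le0 permutes_not_in)
  ultimately have "g i0 \<in> M"
    unfolding M_def by auto
  then obtain x where x: "x \<in> M" and min: "\<And>y. (y, x) \<in> parent_rel U f \<Longrightarrow> y \<notin> M"
    using wfE_min[OF wf] by metis
  obtain i where i: "i < n" "p i \<noteq> i" "x = g i"
    using x unfolding M_def by auto
  have "p i < n"
    using i p by (metis atLeastLessThan_iff le0 permutes_in_image)
  moreover have "p (p i) \<noteq> p i"
    using i p by (metis permutes_inj injD)
  ultimately have "f x \<in> M"
    using move[OF i(1,2)] i unfolding M_def by auto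
  moreover have "x \<in> U"
    using i g bij_betwE by fastforce
  then have "(f x, x) \<in> parent_rel U f"
    unfolding parent_rel_def by auto
  ultimately show False
    using min by blast
qed

text \<open>This determinant separates trees from maps with a cycle. In the well-founded case only
  the identity permutation contributes to the Leibniz expansion, and the diagonal entries are 1;
  otherwise there is a nonzero kernel vector.\<close>

lemma det_parent_mat:
  fixes f :: "'v \<Rightarrow> 'v" and g :: "nat \<Rightarrow> 'v"
  assumes g: "bij_betw g {0..<n} U"
  shows "Determinant.det (Matrix.mat n n (\<lambda>(i, j). of_bool (j = i) - of_bool (f (g i) = g j) :: 'a :: idom))
    = of_bool (wf (parent_rel U f))"
proof -
  let ?M = "Matrix.mat n n (\<lambda>(i, j). of_bool (j = i) - of_bool (f (g i) = g j) :: 'a)"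
  have M: "?M \<in> carrier_mat n n"
    by simp
  have gU: "g i \<in> U" if "i < n" for i
    using that g bij_betwE by fastforce
  show ?thesis
  proof (cases "wf (parent_rel U f)")
    case True
    have entries: "(\<Prod>i=0..<n. ?M $$ (i, p i)) = (\<Prod>i=0..<n. of_bool (p i = i) - of_bool (f (g i) = g (p i)))"
      if "p permutes {0..<n}" for p
      using that by (intro prod.cong) (auto simp: permutes_upt_less)
    have "Determinant.det ?M = (\<Sum>p | p permutes {0..<n}. signof p * (\<Prod>i=0..<n. ?M $$ (i, p i)))"
      by (rule det_def'[OF M])
    also have "\<dots> = (\<Sum>p\<in>{id}. signof p * (\<Prod>i=0..<n. ?M $$ (i, p i)))"
    proof (rule sum.mono_neutral_right)
      show "\<forall>p\<in>{p. p permutes {0..<n}} - {id}. signof p * (\<Prod>i=0..<n. ?M $$ (i, p i)) = 0"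
      proof
        fix p
        assume "p \<in> {p. p permutes {0..<n}} - {id}"
        then have p: "p permutes {0..<n}" "p \<noteq> id"
          by auto
        show "signof p * (\<Prod>i=0..<n. ?M $$ (i, p i)) = 0"
          unfolding entries[OF p(1)] prod_permutes_parent_eq_0[OF True g p] by (rule mult_zero_right)
      qed
    qed (auto simp: finite_permutations permutes_id)
    also have "\<dots> = (\<Prod>i=0..<n. ?M $$ (i, i))"
      by simp
    also have "\<dots> = (\<Prod>i=0..<n. 1)"
      using parent_map_neq[OF True] gU by (intro prod.cong) auto
    finally show ?thesis
      using True by simp
  next
    case False
    then have "\<exists>S x. x \<in> S \<and> (\<forall>z\<in>S. \<exists>y. (y, z) \<in> parent_rel U f \<and> y \<in> S)"
      unfolding wf_eq_minimal not_all not_imp bex_simps not_not by simp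
    then obtain S where S: "S \<noteq> {}" "\<And>z. z \<in> S \<Longrightarrow> \<exists>y. (y, z) \<in> parent_rel U f \<and> y \<in> S"
      by (elim exE conjE) (metis empty_iff)
    text \<open>The largest set of vertices from which the parents never lead out of \<open>U\<close>: its indicator
      vector is in the kernel.\<close>
    define N where "N = \<Union>{S. \<forall>z\<in>S. z \<in> U \<and> f z \<in> S}"
    have "S \<subseteq> N"
      using S(2) unfolding N_def parent_rel_def by blast
    then have "N \<noteq> {}"
      using S(1) by blast
    have N: "z \<in> U \<and> f z \<in> N" if "z \<in> N" for z
      using that unfolding N_def by blast
    \<comment> \<open>Maximality of \<open>N\<close>: inserting such a \<open>z\<close> gives
      another set of the same kind. So a vertex of \<open>U\<close> lies in \<open>N\<close> exactly
      if its parent does.\<close>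
    have N': "z \<in> N" if "z \<in> U" "f z \<in> N" for z
    proof -
      have "\<forall>y \<in> insert z N. y \<in> U \<and> f y \<in> insert z N"
        using that N by blast
      then show ?thesis
        unfolding N_def by blast
    qed
    define w :: "'a Matrix.vec" where "w = Matrix.vec n (\<lambda>i. of_bool (g i \<in> N))"
    obtain z where z: "z \<in> N"
      using \<open>N \<noteq> {}\<close> by blast
    then have "z \<in> g ` {0..<n}"
      using N g by (auto simp: bij_betw_def)
    with z obtain i where i: "i < n" "g i \<in> N"
      by auto
    have "w \<noteq> 0\<^sub>v n"
    proof
      assume "w = 0\<^sub>v n"
      then have "vec_index w i = 0"
        using i by simp
      then show False
        using i unfolding w_def by simp
    qed
    moreover have "?M *\<^sub>v w = 0\<^sub>v n"
    proof (rule eq_vecI)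
      fix i
      assume "i < dim_vec (0\<^sub>v n :: 'a Matrix.vec)"
      then have i: "i < n"
        by simp
      \<comment> \<open>For \<open>x\<close> outside \<open>U\<close> no index matches, and the
        right-hand side vanishes as well because \<open>N\<close> is contained in
        \<open>U\<close>.\<close>
      have inner: "(\<Sum>j=0..<n. of_bool (x = g j) * of_bool (g j \<in> N)) = (of_bool (x \<in> N) :: 'a)" for x
      proof -
        have "(\<Sum>j=0..<n. of_bool (x = g j) * of_bool (g j \<in> N)) = (\<Sum>v\<in>U. of_bool (x = v) * of_bool (v \<in> N) :: 'a)"
          by (rule sum.reindex_bij_betw[OF g, of "\<lambda>v. of_bool (x = v) * of_bool (v \<in> N)"])
        also have "\<dots> = (\<Sum>v\<in>U. if x = v then of_bool (v \<in> N) else 0)"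
          by (intro sum.cong) auto
        also have "\<dots> = of_bool (x \<in> N)"
          using N bij_betw_finite[OF g] by auto
        finally show ?thesis .
      qed
      have eq: "(j = i) = (g i = g j)" if "j < n" for j
        using that i g by (auto simp: bij_betw_def dest: inj_onD)
      have "vec_index (?M *\<^sub>v w) i
          = (\<Sum>j=0..<n. (of_bool (j = i) - of_bool (f (g i) = g j)) * of_bool (g j \<in> N))"
        using i by (simp add: w_def scalar_prod_def)
      also have "\<dots> = (\<Sum>j=0..<n. of_bool (g i = g j) * of_bool (g j \<in> N))
          - (\<Sum>j=0..<n. of_bool (f (g i) = g j) * of_bool (g j \<in> N))"
        unfolding sum_subtractf[symmetric] by (intro sum.cong) (auto simp: eq algebra_simps)
      also have "\<dots> = 0"
        unfolding inner using N[of "g i"] N'[of "g i"] gU[OF i] by auto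
      finally show "vec_index (?M *\<^sub>v w) i = vec_index (0\<^sub>v n) i"
        using i by simp
    qed simp
    moreover have "w \<in> carrier_vec n"
      by (simp add: w_def)
    ultimately have "Determinant.det ?M = 0"
      using det_0_iff_vec_prod_zero[OF M] by blast
    with False show ?thesis
      by simp
  qed
qed

text \<open>Weighted matrix-tree theorem. Row \<open>i\<close> is a combination, with weights
  \<open>W (g i) u\<close>, of rows describing the single choice of \<open>u\<close> as parent of
  \<open>g i\<close>. Multilinearity expands the determinant over all maps \<open>f\<close>, and
  \<open>det_parent_mat\<close> retains exactly the parent maps.\<close>

lemma det_reduced_laplacian:
  fixes W :: "'v \<Rightarrow> 'v \<Rightarrow> 'a :: idom" and g :: "nat \<Rightarrow> 'v"
  assumes g: "bij_betw g {0..<n} (V - {r})" and V: "finite V"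
  shows "Determinant.det (Matrix.mat n n (\<lambda>(i, j).
      \<Sum>u\<in>V. W (g i) u * (of_bool (j = i) - of_bool (u = g j))))
    = (\<Sum>f\<in>parent_maps V r. \<Prod>v\<in>V - {r}. W v (f v))"
proof -
  let ?U = "V - {r}"
  let ?L = "Matrix.mat n n (\<lambda>(i, j). \<Sum>u\<in>V. W (g i) u * (of_bool (j = i) - of_bool (u = g j)))"
  \<comment> \<open>The inverse \<open>h\<close> expresses row indices through vertices, so that
    products over rows become products over \<open>V - {r}\<close>.\<close>
  define h where "h = the_inv_into {0..<n} g"
  have hg: "h (g i) = i" if "i < n" for i
    unfolding h_def using that g by (intro the_inv_into_f_f) (auto simp: bij_betw_def)
  let ?m = "\<lambda>f i j. of_bool (j = i) - of_bool (f (g i) = g j) :: 'a"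
  have prod_L: "(\<Prod>i=0..<n. ?L $$ (i, p i))
      = (\<Sum>f\<in>?U \<rightarrow>\<^sub>E V. (\<Prod>v\<in>?U. W v (f v)) * (\<Prod>i=0..<n. ?m f i (p i)))"
    if p: "p permutes {0..<n}" for p
  proof -
    let ?F = "\<lambda>v u. W v u * (of_bool (p (h v) = h v) - of_bool (u = g (p (h v))))"
    have "(\<Prod>i=0..<n. ?L $$ (i, p i)) = (\<Prod>i=0..<n. \<Sum>u\<in>V. ?F (g i) u)"
      using p by (intro prod.cong) (auto simp: permutes_upt_less hg)
    also have "\<dots> = (\<Prod>v\<in>?U. \<Sum>u\<in>V. ?F v u)"
      by (rule prod.reindex_bij_betw[OF g])
    also have "\<dots> = (\<Sum>f\<in>?U \<rightarrow>\<^sub>E V. \<Prod>v\<in>?U. ?F v (f v))"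
      using V by (intro prod_sum_PiE) auto
    also have "\<dots> = (\<Sum>f\<in>?U \<rightarrow>\<^sub>E V. (\<Prod>v\<in>?U. W v (f v)) * (\<Prod>i=0..<n. ?m f i (p i)))"
    proof (rule sum.cong)
      fix f
      have "(\<Prod>v\<in>?U. of_bool (p (h v) = h v) - of_bool (f v = g (p (h v))))
          = (\<Prod>i=0..<n. of_bool (p (h (g i)) = h (g i)) - of_bool (f (g i) = g (p (h (g i)))) :: 'a)"
        by (rule prod.reindex_bij_betw[OF g, symmetric])
      also have "\<dots> = (\<Prod>i=0..<n. ?m f i (p i))"
        by (intro prod.cong) (auto simp: hg)
      finally show "(\<Prod>v\<in>?U. ?F v (f v)) = (\<Prod>v\<in>?U. W v (f v)) * (\<Prod>i=0..<n. ?m f i (p i))"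
        by (simp add: prod.distrib)
    qed simp
    finally show ?thesis .
  qed
  have det_m: "(\<Sum>p | p permutes {0..<n}. signof p * (\<Prod>i=0..<n. ?m f i (p i))) = of_bool (wf (parent_rel ?U f))"
    for f
  proof -
    have "(\<Sum>p | p permutes {0..<n}. signof p * (\<Prod>i=0..<n. ?m f i (p i)))
        = Determinant.det (Matrix.mat n n (\<lambda>(i, j). ?m f i j))"
      by (subst det_def'[of _ n]) (auto intro!: sum.cong prod.cong simp: permutes_upt_less)
    also have "\<dots> = of_bool (wf (parent_rel ?U f))"
      by (rule det_parent_mat[OF g])
    finally show ?thesis .
  qed
  have "Determinant.det ?L = (\<Sum>p | p permutes {0..<n}. signof p * (\<Prod>i=0..<n. ?L $$ (i, p i)))"
    by (rule det_def') simp
  also have "\<dots> = (\<Sum>p | p permutes {0..<n}. \<Sum>f\<in>?U \<rightarrow>\<^sub>E V.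
      (\<Prod>v\<in>?U. W v (f v)) * (signof p * (\<Prod>i=0..<n. ?m f i (p i))))"
    by (intro sum.cong refl) (simp only: mem_Collect_eq prod_L sum_distrib_left mult.left_commute)
  also have "\<dots> = (\<Sum>f\<in>?U \<rightarrow>\<^sub>E V. (\<Prod>v\<in>?U. W v (f v)) * of_bool (wf (parent_rel ?U f)))"
    by (subst sum.swap) (simp only: det_m sum_distrib_left[symmetric])
  also have "\<dots> = (\<Sum>f\<in>parent_maps V r. (\<Prod>v\<in>?U. W v (f v)) * of_bool (wf (parent_rel ?U f)))"
    using V by (intro sum.mono_neutral_right) (auto simp: parent_maps_def intro: finite_PiE)
  also have "\<dots> = (\<Sum>f\<in>parent_maps V r. \<Prod>v\<in>?U. W v (f v))"
    by (intro sum.cong) (auto simp: parent_maps_def)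
  finally show ?thesis .
qed

text \<open>A vanishing tree sum makes the reduced Laplacian singular; \<open>\<phi>\<close> is a
  kernel vector extended by 0 to the root.\<close>

lemma laplacian_kernel:
  fixes W :: "'v \<Rightarrow> 'v \<Rightarrow> 'a :: idom"
  assumes V: "finite V" and r: "r \<in> V"
    and zero: "(\<Sum>f\<in>parent_maps V r. \<Prod>v\<in>V - {r}. W v (f v)) = 0"
  obtains \<phi> :: "'v \<Rightarrow> 'a" where "\<phi> r = 0" "\<exists>v\<in>V. \<phi> v \<noteq> 0"
    "\<And>v. v \<in> V - {r} \<Longrightarrow> (\<Sum>u\<in>V. W v u * (\<phi> v - \<phi> u)) = 0"
proof -
  let ?U = "V - {r}"
  define n where "n = card ?U"
  obtain g where g: "bij_betw g {0..<n} ?U"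
    using ex_bij_betw_nat_finite[of ?U] V unfolding n_def by auto
  let ?L = "Matrix.mat n n (\<lambda>(i, j). \<Sum>u\<in>V. W (g i) u * (of_bool (j = i) - of_bool (u = g j)))"
  have "Determinant.det ?L = 0"
    unfolding det_reduced_laplacian[OF g V] by (rule zero)
  then obtain w where w: "w \<in> carrier_vec n" "w \<noteq> 0\<^sub>v n" "?L *\<^sub>v w = 0\<^sub>v n"
    using det_0_iff_vec_prod_zero[of ?L n] by auto
  define h where "h = the_inv_into {0..<n} g"
  have hg: "h (g i) = i" if "i < n" for i
    unfolding h_def using that g by (intro the_inv_into_f_f) (auto simp: bij_betw_def)
  have gU: "g i \<in> ?U" if "i < n" for i
    using that g bij_betwE by fastforce
  define \<phi> where "\<phi> v = (if v = r then 0 else vec_index w (h v))" for v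
  have \<phi>g: "\<phi> (g i) = vec_index w i" if "i < n" for i
    using that gU[OF that] by (simp add: \<phi>_def hg)
  \<comment> \<open>At \<open>u = r\<close> no index matches, in agreement with the value 0 chosen
    for \<open>\<phi> r\<close>.\<close>
  have sum_g: "(\<Sum>j=0..<n. of_bool (u = g j) * vec_index w j) = \<phi> u" if "u \<in> V" for u
  proof -
    have "(\<Sum>j=0..<n. of_bool (u = g j) * vec_index w j) = (\<Sum>j=0..<n. of_bool (u = g j) * \<phi> (g j))"
      by (intro sum.cong) (auto simp: \<phi>g)
    also have "\<dots> = (\<Sum>v\<in>?U. of_bool (u = v) * \<phi> v)"
      by (rule sum.reindex_bij_betw[OF g, of "\<lambda>v. of_bool (u = v) * \<phi> v"])
    also have "\<dots> = (\<Sum>v\<in>?U. if u = v then \<phi> v else 0)"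
      by (intro sum.cong) auto
    also have "\<dots> = \<phi> u"
      using that V by (auto simp: \<phi>_def)
    finally show ?thesis .
  qed
  show thesis
  proof
    show "\<phi> r = 0"
      by (simp add: \<phi>_def)
    have "\<exists>i<n. vec_index w i \<noteq> 0"
      using w(1,2) by (metis carrier_vecD eq_vecI index_zero_vec)
    with gU \<phi>g show "\<exists>v\<in>V. \<phi> v \<noteq> 0"
      by (metis DiffD1)
    fix v
    assume "v \<in> ?U"
    then have "v \<in> g ` {0..<n}"
      using g by (simp add: bij_betw_def)
    then obtain i where i: "i < n" "v = g i"
      by auto
    have row: "(\<Sum>j=0..<n. (of_bool (j = i) - of_bool (u = g j)) * vec_index w j) = \<phi> v - \<phi> u"
      if "u \<in> V" for u
    proof -
      have "(\<Sum>j=0..<n. of_bool (j = i) * vec_index w j) = (\<Sum>j=0..<n. if j = i then vec_index w j else 0)"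
        by (intro sum.cong) auto
      also have "\<dots> = \<phi> v"
        using i by (simp add: \<phi>g)
      finally show ?thesis
        using sum_g[OF that] by (simp add: left_diff_distrib sum_subtractf)
    qed
    have "0 = vec_index (?L *\<^sub>v w) i"
      using w(3) i by simp
    also have "\<dots> = (\<Sum>j=0..<n. (\<Sum>u\<in>V. W v u * (of_bool (j = i) - of_bool (u = g j))) * vec_index w j)"
      using i w(1) by (simp add: scalar_prod_def)
    also have "\<dots> = (\<Sum>u\<in>V. W v u * (\<Sum>j=0..<n. (of_bool (j = i) - of_bool (u = g j)) * vec_index w j))"
      unfolding sum_distrib_left sum_distrib_right by (subst sum.swap) (simp add: mult_ac)
    also have "\<dots> = (\<Sum>u\<in>V. W v u * (\<phi> v - \<phi> u))"
      by (intro sum.cong) (auto simp: row)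
    finally show "(\<Sum>u\<in>V. W v u * (\<phi> v - \<phi> u)) = 0"
      by simp
  qed
qed

section \<open>Real-rooted polynomials\<close>

text \<open>Roots are split off one at a time by the fundamental theorem of algebra. From
  \<open>1 + of_real \<mu> * t = 0\<close> follows
  \<open>[:-t, 1:] = Polynomial.smult (-t) [:1, of_real \<mu>:]\<close>.\<close>

lemma complex_poly_eq_prod_list:
  fixes p :: "complex poly"
  assumes "poly p 0 \<noteq> 0"
    and "\<And>t. poly p t = 0 \<Longrightarrow> \<exists>\<mu>::real. -1 \<le> \<mu> \<and> 1 + of_real \<mu> * t = 0"
  shows "\<exists>ms. (\<forall>\<mu>\<in>set ms. -1 \<le> \<mu>) \<and> p = Polynomial.smult (poly p 0) (\<Prod>\<mu>\<leftarrow>ms. [:1, of_real \<mu>:])"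
  using assms
proof (induction "degree p" arbitrary: p)
  case 0
  then obtain c where "p = [:c:]"
    by (metis degree_eq_zeroE)
  then show ?case
    by (intro exI[of _ "[]"]) auto
next
  case (Suc n)
  have "\<not> constant (poly p)"
    using Suc.hyps(2) by (simp add: constant_degree)
  then obtain t where t: "poly p t = 0"
    using fundamental_theorem_of_algebra by blast
  obtain \<mu> :: real where \<mu>: "-1 \<le> \<mu>" "1 + of_real \<mu> * t = 0"
    using Suc.prems(2)[OF t] by blast
  obtain q where q: "p = [:-t, 1:] * q"
    using t by (metis dvd_def poly_eq_0_iff_dvd)
  \<comment> \<open>Absorbing \<open>-t\<close> into the cofactor keeps the value at 0, so the
    hypotheses pass on to \<open>s\<close>.\<close>
  define s where "s = Polynomial.smult (-t) q"
  have "of_real \<mu> * (- t) = 1"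
    using \<mu>(2) by (simp add: add_eq_0_iff)
  then have "[:-t, 1:] = Polynomial.smult (-t) [:1, of_real \<mu>:]"
    by (simp add: mult.commute)
  then have p: "p = [:1, of_real \<mu>:] * s"
    unfolding q s_def by (simp only: mult_smult_left mult_smult_right)
  have s0: "poly s 0 = poly p 0"
    unfolding p by simp
  have "s \<noteq> 0"
    using Suc.prems(1) s0 by auto
  have "t \<noteq> 0"
    using \<mu>(2) by auto
  then have "degree p = Suc (degree s)"
    using \<open>s \<noteq> 0\<close> unfolding q s_def by (subst degree_mult_eq) auto
  then have "n = degree s"
    using Suc.hyps(2) by simp
  moreover have "\<exists>\<mu>::real. -1 \<le> \<mu> \<and> 1 + of_real \<mu> * t = 0" if "poly s t = 0" for t
    using Suc.prems(2)[of t] that unfolding p by simp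
  ultimately obtain ms where ms: "\<forall>\<mu>\<in>set ms. -1 \<le> \<mu>"
      "s = Polynomial.smult (poly s 0) (\<Prod>\<mu>\<leftarrow>ms. [:1, of_real \<mu>:])"
    using Suc.hyps(1)[of s] Suc.prems(1) s0 by auto
  have "p = Polynomial.smult (poly p 0) (\<Prod>\<mu>\<leftarrow>\<mu> # ms. [:1, of_real \<mu>:])"
    by (subst p, subst ms(2)) (simp add: s0)
  with \<mu>(1) ms(1) show ?case
    by (intro exI[of _ "\<mu> # ms"]) auto
qed

lemma coeff_0_1_prod_list_linear:
  fixes ms :: "real list"
  defines "P \<equiv> (\<Prod>\<mu>\<leftarrow>ms. [:1, of_real \<mu>:]) :: complex poly"
  shows "coeff P 0 = 1 \<and> coeff P 1 = of_real (sum_list ms)"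
  unfolding P_def by (induction ms) (auto simp: coeff_pCons)

text \<open>Nonnegativity is proved along with the bound because the induction multiplies
  inequalities.\<close>

lemma prod_list_le_exp_sum_list:
  fixes ms :: "real list"
  assumes "\<forall>\<mu>\<in>set ms. -1 \<le> \<mu>"
  shows "0 \<le> (\<Prod>\<mu>\<leftarrow>ms. 1 + \<mu>) \<and> (\<Prod>\<mu>\<leftarrow>ms. 1 + \<mu>) \<le> exp (sum_list ms)"
  using assms by (induction ms) (auto simp: exp_add intro!: mult_mono exp_ge_add_one_self)

text \<open>The linear coefficient is \<open>c * sum_list ms\<close>, so the slopes sum to 0 and the
  product of the \<open>1 + \<mu>\<close> is at most \<open>exp 0\<close>.\<close>

lemma poly_1_le_poly_0:
  fixes p :: "complex poly" and c :: real
  assumes p0: "poly p 0 = of_real c" and "0 < c" and deriv: "Re (coeff p 1) = 0"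
    and roots: "\<And>t. poly p t = 0 \<Longrightarrow> \<exists>\<mu>::real. -1 \<le> \<mu> \<and> 1 + of_real \<mu> * t = 0"
  shows "Re (poly p 1) \<le> c"
proof -
  obtain ms where ms: "\<forall>\<mu>\<in>set ms. -1 \<le> \<mu>"
      "p = Polynomial.smult (of_real c) (\<Prod>\<mu>\<leftarrow>ms. [:1, of_real \<mu>:])"
    using complex_poly_eq_prod_list[of p] roots p0 \<open>0 < c\<close> by auto
  have "c * sum_list ms = Re (coeff p 1)"
    using coeff_0_1_prod_list_linear[of ms] by (subst ms(2)) simp
  then have "sum_list ms = 0"
    using deriv \<open>0 < c\<close> by simp
  moreover have "poly (\<Prod>\<mu>\<leftarrow>ms. [:1, of_real \<mu>:]) (1::complex) = of_real (\<Prod>\<mu>\<leftarrow>ms. 1 + \<mu>)"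
    by (induction ms) (auto simp: algebra_simps)
  then have "poly p 1 = of_real (c * (\<Prod>\<mu>\<leftarrow>ms. 1 + \<mu>))"
    by (subst ms(2)) simp
  ultimately show ?thesis
    using prod_list_le_exp_sum_list[OF ms(1)] \<open>0 < c\<close> by (simp add: mult_left_le)
qed

section \<open>Critical points of the weighted tree number\<close>

lemma finite_simple_graph_finite_edges: "finite_simple_graph V E \<Longrightarrow> finite E"
  unfolding finite_simple_graph_def by (auto intro: finite_subset[of E "Pow V"])

text \<open>Brings the tree sum into the form of the matrix-tree theorem: weight 0 on non-edges
  removes the parent maps that leave \<open>E\<close>.\<close>

lemma weighted_spanning_tree_sum_eq:
  fixes w :: "'v set \<Rightarrow> 'a :: comm_ring_1"
  assumes G: "finite_simple_graph V E" and r: "r \<in> V"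
  shows "(\<Sum>T\<in>spanning_trees V E. \<Prod>a\<in>T. w a)
    = (\<Sum>f\<in>parent_maps V r. \<Prod>v\<in>V - {r}. if {v, f v} \<in> E then w {v, f v} else 0)"
proof -
  let ?U = "V - {r}"
  let ?P = "{f \<in> parent_maps V r. parent_edges ?U f \<subseteq> E}"
  have V: "finite V"
    using G unfolding finite_simple_graph_def by auto
  have fin: "finite (parent_maps V r)"
    using V by (intro finite_subset[OF _ finite_PiE[of ?U "\<lambda>_. V"]]) (auto simp: parent_maps_def)
  have "(\<Sum>T\<in>spanning_trees V E. \<Prod>a\<in>T. w a) = (\<Sum>f\<in>?P. \<Prod>a\<in>parent_edges ?U f. w a)"
    by (rule sum.reindex_bij_betw[OF bij_betw_parent_maps_spanning_trees[OF G r], symmetric])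
  also have "\<dots> = (\<Sum>f\<in>?P. \<Prod>v\<in>?U. if {v, f v} \<in> E then w {v, f v} else 0)"
  proof (rule sum.cong)
    fix f
    assume f: "f \<in> ?P"
    then have "inj_on (\<lambda>v. {v, f v}) ?U"
      by (intro inj_on_parent_edge) (auto simp: parent_maps_def)
    then have "(\<Prod>a\<in>parent_edges ?U f. w a) = (\<Prod>v\<in>?U. w {v, f v})"
      unfolding parent_edges_def by (simp add: prod.reindex)
    also have "\<dots> = (\<Prod>v\<in>?U. if {v, f v} \<in> E then w {v, f v} else 0)"
      using f by (intro prod.cong) (auto simp: parent_edges_def)
    finally show "(\<Prod>a\<in>parent_edges ?U f. w a) = (\<Prod>v\<in>?U. if {v, f v} \<in> E then w {v, f v} else 0)" .
  qed simp
  also have "\<dots> = (\<Sum>f\<in>parent_maps V r. \<Prod>v\<in>?U. if {v, f v} \<in> E then w {v, f v} else 0)"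
  proof (rule sum.mono_neutral_left[OF fin])
    show "\<forall>f\<in>parent_maps V r - ?P. (\<Prod>v\<in>?U. if {v, f v} \<in> E then w {v, f v} else 0) = 0"
    proof
      fix f
      assume "f \<in> parent_maps V r - ?P"
      then obtain v where "v \<in> ?U" "{v, f v} \<notin> E"
        unfolding parent_edges_def by auto
      then show "(\<Prod>v\<in>?U. if {v, f v} \<in> E then w {v, f v} else 0) = 0"
        using V by (intro prod_zero) auto
    qed
  qed auto
  finally show ?thesis .
qed

text \<open>Pairing the Laplacian of the kernel function \<open>\<phi>\<close> with its conjugate
  gives a vanishing energy. If all \<open>D a\<close> on edges were 0, connectedness would make
  \<open>\<phi>\<close> constant, hence equal to \<open>\<phi> r = 0\<close>.\<close>

lemma energy_zero_if_weighted_spanning_tree_sum_zero: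
  fixes w :: "'v set \<Rightarrow> complex"
  assumes G: "finite_simple_graph V E" and conn: "connected_graph V E"
    and zero: "(\<Sum>T\<in>spanning_trees V E. \<Prod>a\<in>T. w a) = 0"
  obtains D :: "'v set \<Rightarrow> real" where "\<And>a. 0 \<le> D a" "\<exists>a\<in>E. 0 < D a"
    "(\<Sum>a\<in>E. of_real (D a) * w a) = 0"
proof -
  have V: "finite V" and edge: "\<And>a. a \<in> E \<Longrightarrow> a \<subseteq> V" and "V \<noteq> {}"
    using G conn unfolding finite_simple_graph_def connected_graph_def by auto
  have E: "finite E"
    by (rule finite_simple_graph_finite_edges[OF G])
  obtain r where r: "r \<in> V"
    using \<open>V \<noteq> {}\<close> by auto
  define W where "W v u = (if {v, u} \<in> E then w {v, u} else 0)" for v u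
  have W_sym: "W v u = W u v" for u v
    unfolding W_def by (simp add: insert_commute)
  have zero': "(\<Sum>f\<in>parent_maps V r. \<Prod>v\<in>V - {r}. W v (f v)) = 0"
    using zero unfolding weighted_spanning_tree_sum_eq[OF G r] W_def .
  obtain \<phi> where \<phi>: "\<phi> r = 0" "\<exists>v\<in>V. \<phi> v \<noteq> 0"
    "\<And>v. v \<in> V - {r} \<Longrightarrow> (\<Sum>u\<in>V. W v u * (\<phi> v - \<phi> u)) = 0"
    by (rule laplacian_kernel[OF V r zero']) (rule that)
  define d where "d p = (cmod (\<phi> (fst p) - \<phi> (snd p)))\<^sup>2" for p
  \<comment> \<open>Both orientations of an edge are counted; the resulting factor 2 is
    harmless.\<close>
  define D where "D a = (\<Sum>p\<in>{p \<in> V \<times> V. {fst p, snd p} = a}. d p)" for a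
  \<comment> \<open>The kernel equation is known only away from \<open>r\<close>; the term at
    \<open>r\<close> vanishes because \<open>\<phi> r = 0\<close>.\<close>
  have "(\<Sum>v\<in>V. cnj (\<phi> v) * (\<Sum>u\<in>V. W v u * (\<phi> v - \<phi> u))) = 0"
    using \<phi>(1,3) by (intro sum.neutral) (metis DiffI complex_cnj_zero empty_iff insert_iff mult_zero_left mult_zero_right)
  then have S: "(\<Sum>v\<in>V. \<Sum>u\<in>V. W v u * (cnj (\<phi> v) * (\<phi> v - \<phi> u))) = 0"
    by (simp add: sum_distrib_left mult_ac)
  \<comment> \<open>Exchanging \<open>u\<close> and \<open>v\<close> uses the symmetry of
    \<open>W\<close>; adding \<open>S\<close> and \<open>S'\<close> produces the squared
    differences.\<close>
  then have S': "(\<Sum>v\<in>V. \<Sum>u\<in>V. W v u * (cnj (\<phi> u) * (\<phi> u - \<phi> v))) = 0"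
    by (subst sum.swap) (simp add: W_sym)
  have "0 = (\<Sum>v\<in>V. \<Sum>u\<in>V. W v u * of_real (d (v, u)))"
  proof -
    have "of_real (d (v, u)) = cnj (\<phi> v) * (\<phi> v - \<phi> u) + cnj (\<phi> u) * (\<phi> u - \<phi> v)" for u v
      unfolding d_def complex_norm_square by (simp add: algebra_simps)
    then show ?thesis
      using S S' by (simp add: distrib_left sum.distrib)
  qed
  also have "\<dots> = (\<Sum>p\<in>V \<times> V. W (fst p) (snd p) * of_real (d p))"
    by (simp add: sum.cartesian_product case_prod_beta)
  also have "\<dots> = (\<Sum>p\<in>{p \<in> V \<times> V. {fst p, snd p} \<in> E}. w {fst p, snd p} * of_real (d p))"
    using V by (intro sum.mono_neutral_cong_right) (auto simp: W_def)
  also have "\<dots> = (\<Sum>a\<in>E. \<Sum>p\<in>{p \<in> {p \<in> V \<times> V. {fst p, snd p} \<in> E}. {fst p, snd p} = a}.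
      w {fst p, snd p} * of_real (d p))"
    using V E by (intro sum.group[symmetric]) auto
  also have "\<dots> = (\<Sum>a\<in>E. of_real (D a) * w a)"
    unfolding D_def of_real_sum sum_distrib_right by (intro sum.cong) auto
  finally have sum0: "(\<Sum>a\<in>E. of_real (D a) * w a) = 0"
    by simp
  have nonneg: "0 \<le> D a" for a
    unfolding D_def d_def by (intro sum_nonneg) auto
  have "\<exists>a\<in>E. 0 < D a"
  proof (rule ccontr)
    assume neg: "\<not> ?thesis"
    have same: "\<phi> u = \<phi> v" if "{u, v} \<in> E" for u v
    proof -
      have "D {u, v} = 0"
        using neg nonneg that by (metis order_le_less)
      moreover have "(u, v) \<in> V \<times> V"
        using edge[OF that] by auto
      ultimately have "d (u, v) = 0"
        using V unfolding D_def by (subst (asm) sum_nonneg_eq_0_iff) (auto simp: d_def)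
      then show ?thesis
        unfolding d_def by simp
    qed
    have "\<phi> u = \<phi> v" if "(u, v) \<in> (adjacency E)\<^sup>*" for u v
      using that by induction (auto simp: adjacency_def dest: same)
    then show False
      using \<phi>(1,2) conn r unfolding connected_graph_def by metis
  qed
  with nonneg sum0 that show thesis
    by blast
qed

text \<open>The energy is linear in the weights: \<open>A\<close> belongs to \<open>z\<close> and
  \<open>A + B\<close> to \<open>z + y\<close>, so \<open>B\<close> is a difference of energies.
  From \<open>A > 0\<close> and \<open>A + B \<ge> 0\<close> the ratio \<open>\<mu> = B / A\<close>
  is at least -1.\<close>

lemma weighted_tree_number_root:
  fixes z y :: "'v set \<Rightarrow> real" and t :: complex
  assumes G: "finite_simple_graph V E" and conn: "connected_graph V E"
    and z: "\<And>a. a \<in> E \<Longrightarrow> 0 < z a" and zy: "\<And>a. a \<in> E \<Longrightarrow> 0 \<le> z a + y a"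
    and zero: "(\<Sum>T\<in>spanning_trees V E. \<Prod>a\<in>T. of_real (z a) + t * of_real (y a)) = 0"
  shows "\<exists>\<mu>::real. -1 \<le> \<mu> \<and> 1 + of_real \<mu> * t = 0"
proof -
  obtain D :: "'v set \<Rightarrow> real" where D: "\<And>a. 0 \<le> D a" "\<exists>a\<in>E. 0 < D a"
    "(\<Sum>a\<in>E. of_real (D a) * (of_real (z a) + t * of_real (y a))) = 0"
    using energy_zero_if_weighted_spanning_tree_sum_zero[OF G conn zero] by blast
  have E: "finite E"
    by (rule finite_simple_graph_finite_edges[OF G])
  define A B where "A = (\<Sum>a\<in>E. D a * z a)" and "B = (\<Sum>a\<in>E. D a * y a)"
  have "of_real A + t * of_real B = 0"
    using D(3) by (simp add: A_def B_def distrib_left sum.distrib sum_distrib_left mult_ac)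
  moreover have "0 < A"
    unfolding A_def using D(1,2) E z by (auto intro!: sum_pos2 simp: less_imp_le)
  moreover have "0 \<le> A + B"
    unfolding A_def B_def sum.distrib[symmetric] distrib_left[symmetric]
    using D(1) zy by (intro sum_nonneg) auto
  ultimately show ?thesis
    by (intro exI[of _ "B / A"]) (auto simp: field_simps)
qed

lemma weighted_tree_number_eq_sum_edges:
  assumes e: "bij_betw e {1..m} E"
  shows "weighted_tree_number V E m e x
    = (\<Sum>T\<in>spanning_trees V E. \<Prod>a\<in>T. x (the_inv_into {1..m} e a))"
  unfolding weighted_tree_number_def
proof (rule sum.cong)
  fix T
  assume "T \<in> spanning_trees V E"
  then have "T \<subseteq> E"
    unfolding spanning_trees_def by auto
  then have "e ` {j \<in> {1..m}. e j \<in> T} = T"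
    using e unfolding bij_betw_def by blast
  then have "bij_betw e {j \<in> {1..m}. e j \<in> T} T"
    by (intro bij_betw_subset[OF e]) auto
  then have "(\<Prod>a\<in>T. x (the_inv_into {1..m} e a))
      = (\<Prod>j\<in>{j \<in> {1..m}. e j \<in> T}. x (the_inv_into {1..m} e (e j)))"
    by (rule prod.reindex_bij_betw[symmetric])
  also have "\<dots> = (\<Prod>j\<in>{j \<in> {1..m}. e j \<in> T}. x j)"
    using e by (intro prod.cong) (auto simp: bij_betw_def the_inv_into_f_f)
  finally show "(\<Prod>j\<in>{j \<in> {1..m}. e j \<in> T}. x j) = (\<Prod>a\<in>T. x (the_inv_into {1..m} e a))"
    by simp
qed simp

lemma critical_point_imp_global_max:
  fixes V :: "'v set"
  assumes G: "finite_simple_graph V E" and conn: "connected_graph V E" and e: "bij_betw e {1..m} E"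
    and zi: "z \<in> edge_polytope_interior m"
    and crit: "critical_point m (weighted_tree_number V E m e) z"
  shows "global_max_on (weighted_tree_number V E m e) (edge_polytope m) z"
  unfolding global_max_on_def
proof (intro conjI ballI)
  let ?\<tau> = "weighted_tree_number V E m e"
  show z: "z \<in> edge_polytope m"
    using zi unfolding edge_polytope_interior_def by auto
  fix x
  assume x: "x \<in> edge_polytope m"
  define i where "i = the_inv_into {1..m} e"
  define y where "y j = x j - z j" for j
  have i: "i a \<in> {1..m}" if "a \<in> E" for a
    unfolding i_def using e that by (intro the_inv_into_into) (auto simp: bij_betw_def)
  \<comment> \<open>The tree number along the line from \<open>z\<close> to \<open>x\<close>, taken
    over the complex numbers to have all its roots available.\<close>
  define p :: "complex poly" where
    "p = (\<Sum>T\<in>spanning_trees V E. \<Prod>a\<in>T. [:of_real (z (i a)), of_real (y (i a)):])"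
  have poly_p: "poly p t = (\<Sum>T\<in>spanning_trees V E. \<Prod>a\<in>T. of_real (z (i a)) + t * of_real (y (i a)))" for t
    unfolding p_def by (simp add: poly_sum poly_prod)
  have poly_p_real: "poly p (of_real t) = of_real (?\<tau> (\<lambda>j. z j + t * y j))" for t
    unfolding poly_p weighted_tree_number_eq_sum_edges[OF e] i_def by simp
  have p0: "poly p 0 = of_real (?\<tau> z)" and p1: "poly p 1 = of_real (?\<tau> x)"
    using poly_p_real[of 0] poly_p_real[of 1] by (simp_all add: y_def)
  have roots: "\<exists>\<mu>::real. -1 \<le> \<mu> \<and> 1 + of_real \<mu> * t = 0" if "poly p t = 0" for t
  proof (rule weighted_tree_number_root[OF G conn])
    show "0 < z (i a)" if "a \<in> E" for a
      using zi i[OF that] unfolding edge_polytope_interior_def by auto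
    show "0 \<le> z (i a) + y (i a)" if "a \<in> E" for a
      using x i[OF that] unfolding edge_polytope_def y_def by auto
    show "(\<Sum>T\<in>spanning_trees V E. \<Prod>a\<in>T. of_real (z (i a)) + t * of_real (y (i a))) = 0"
      using that by (simp add: poly_p)
  qed
  \<comment> \<open>The root criterion excludes \<open>t = 0\<close>, since
    \<open>1 + of_real \<mu> * 0\<close> is 1.\<close>
  have "?\<tau> z \<noteq> 0"
    using roots[of 0] p0 by auto
  moreover have "0 \<le> ?\<tau> z"
    using z unfolding weighted_tree_number_def edge_polytope_def
    by (auto intro!: sum_nonneg prod_nonneg)
  ultimately have pos: "0 < ?\<tau> z"
    by simp
  have "y \<in> tuples m" "(\<Sum>j=1..m. y j) = 0"
    using x z unfolding y_def edge_polytope_def tuples_def by (auto simp: sum_subtractf)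
  then have "((\<lambda>t. ?\<tau> (\<lambda>j. z j + t * y j)) has_real_derivative 0) (at 0)"
    using crit unfolding critical_point_def by auto
  \<comment> \<open>The directional derivative is the linear coefficient of \<open>p\<close>;
    uniqueness of derivatives then turns criticality into its vanishing.\<close>
  moreover have "((\<lambda>t. ?\<tau> (\<lambda>j. z j + t * y j)) has_real_derivative Re (coeff p 1)) (at 0)"
  proof -
    have "((\<lambda>t. poly p (of_real t)) has_vector_derivative poly (pderiv p) (of_real 0)) (at 0)"
      by (rule has_vector_derivative_real_field) (rule poly_DERIV)
    then have "((\<lambda>t. Re (poly p (of_real t))) has_vector_derivative Re (poly (pderiv p) (of_real 0))) (at 0)"
      by (rule bounded_linear.has_vector_derivative[OF bounded_linear_Re])
    then show ?thesis
      by (simp add: poly_p_real has_real_derivative_iff_has_vector_derivative poly_0_coeff_0 coeff_pderiv)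
  qed
  ultimately have "Re (coeff p 1) = 0"
    by (rule DERIV_unique[symmetric])
  then show "?\<tau> x \<le> ?\<tau> z"
    using poly_1_le_poly_0[OF p0 pos _ roots] p1 by simp
qed

section \<open>Equiarboreal graphs\<close>

lemma unweighted_in_interior: "unweighted m \<in> edge_polytope_interior m"
  unfolding edge_polytope_interior_def edge_polytope_def tuples_def unweighted_def by auto

text \<open>At the all-ones point the derivative along \<open>y\<close> is the sum of
  \<open>y j\<close> over all pairs of a tree and an edge \<open>e j\<close> in it. Counting by
  edges gives \<open>N\<close> times the sum of the \<open>y j\<close>, which is 0.\<close>

lemma equiarboreal_imp_critical_point:
  fixes V :: "'v set"
  assumes e: "bij_betw e {1..m} E" and equi: "equiarboreal V E"
  shows "critical_point m (weighted_tree_number V E m e) (unweighted m)"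
  unfolding critical_point_def
proof (intro conjI ballI impI)
  show "unweighted m \<in> edge_polytope m"
    using unweighted_in_interior unfolding edge_polytope_interior_def by auto
  fix y :: "nat \<Rightarrow> real"
  assume sum0: "(\<Sum>j=1..m. y j) = 0"
  let ?S = "spanning_trees V E"
  have "finite E"
    using e bij_betw_finite by blast
  then have fin: "finite ?S"
    by (auto simp: spanning_trees_def intro: finite_subset[of _ "Pow E"])
  \<comment> \<open>The common count is read off at some edge; if \<open>E\<close> is empty, any
    number serves.\<close>
  have "\<exists>N. \<forall>a\<in>E. card {T \<in> ?S. a \<in> T} = N"
  proof (cases "E = {}")
    case False
    then obtain b where "b \<in> E"
      by blast
    with equi show ?thesis
      unfolding equiarboreal_def by (intro exI[of _ "card {T \<in> ?S. b \<in> T}"]) blast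
  qed auto
  then obtain N where N: "\<And>a. a \<in> E \<Longrightarrow> card {T \<in> ?S. a \<in> T} = N"
    by auto
  have eE: "e j \<in> E" if "j \<in> {1..m}" for j
    using that e bij_betwE by blast
  let ?J = "\<lambda>T. {j \<in> {1..m}. e j \<in> T}"
  have "(\<Sum>T\<in>?S. \<Sum>j\<in>?J T. y j) = (\<Sum>T\<in>?S. \<Sum>j\<in>{1..m}. if e j \<in> T then y j else 0)"
    by (intro sum.cong sum.inter_filter) auto
  also have "\<dots> = (\<Sum>j\<in>{1..m}. \<Sum>T\<in>?S. if e j \<in> T then y j else 0)"
    by (rule sum.swap)
  also have "\<dots> = (\<Sum>j\<in>{1..m}. real N * y j)"
  proof (rule sum.cong)
    fix j
    assume "j \<in> {1..m}"
    then have "card {T \<in> ?S. e j \<in> T} = N"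
      using N eE by blast
    then show "(\<Sum>T\<in>?S. if e j \<in> T then y j else 0) = real N * y j"
      by (simp add: sum.inter_filter[OF fin, symmetric])
  qed simp
  also have "\<dots> = 0"
    using sum0 by (simp add: sum_distrib_left[symmetric])
  finally have total: "(\<Sum>T\<in>?S. \<Sum>j\<in>?J T. y j) = 0" .
  have "((\<lambda>t. \<Sum>T\<in>?S. \<Prod>j\<in>?J T. unweighted m j + t * y j) has_real_derivative
      (\<Sum>T\<in>?S. \<Sum>j\<in>?J T. y j * (\<Prod>k\<in>?J T - {j}. unweighted m k + 0 * y k))) (at 0)"
    by (intro DERIV_sum has_field_derivative_prod) (auto intro!: derivative_eq_intros)
  moreover have "(\<Sum>T\<in>?S. \<Sum>j\<in>?J T. y j * (\<Prod>k\<in>?J T - {j}. unweighted m k + 0 * y k)) = 0"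
  proof -
    have "(\<Prod>k\<in>?J T - {j}. unweighted m k + 0 * y k) = 1" for T j
      by (intro prod.neutral) (auto simp: unweighted_def)
    then show ?thesis
      using total by simp
  qed
  ultimately show "((\<lambda>t. weighted_tree_number V E m e (\<lambda>j. unweighted m j + t * y j))
      has_real_derivative 0) (at 0)"
    unfolding weighted_tree_number_def by simp
qed

theorem corollary2p5:
  fixes V :: "'v set" and E :: "'v set set" and m :: nat and e :: "nat \<Rightarrow> 'v set"
  assumes "finite_simple_graph V E"
    and "connected_graph V E"
    and "bij_betw e {1..m} E"
  shows "(\<forall>z. z \<in> edge_polytope_interior m \<and> critical_point m (weighted_tree_number V E m e) z \<longrightarrow>
            global_max_on (weighted_tree_number V E m e) (edge_polytope m) z) \<and>
         (equiarboreal V E \<longrightarrow>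
            global_max_on (weighted_tree_number V E m e) (edge_polytope m) (unweighted m))"
proof (intro conjI allI impI; (elim conjE)?)
  fix z
  assume "z \<in> edge_polytope_interior m" "critical_point m (weighted_tree_number V E m e) z"
  then show "global_max_on (weighted_tree_number V E m e) (edge_polytope m) z"
    by (rule critical_point_imp_global_max[OF assms])
next
  assume "equiarboreal V E"
  then show "global_max_on (weighted_tree_number V E m e) (edge_polytope m) (unweighted m)"
    using critical_point_imp_global_max[OF assms unweighted_in_interior]
      equiarboreal_imp_critical_point[OF assms(3)] by blast
qed

end
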